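(* Let $k\ge1$, let $w$ be an infinite word over $[k]$, let $d,L\ge 0$ be integers, and let $w'$ be a word over $[k]$ of length at least $L+1$. Then the values $P_0(L+1),\dots,P_d(L+1)$ are obtained from $P_0(L),\dots,P_d(L)$ as follows. Let \[ A[L]=\{\,i\in\{0,1,\dots,d\} : w[P_i(L)]=w'[L]\,\}. \] Then for each $i=0,1,\dots,d$ (in this order): \begin{itemize} \item if $i\in A[L]$, then $P_i(L+1)=P_i(L)+1$; \item if $i\notin A[L]$, then $P_i(L+1)=\max\bigl(P_i(L),\,P_{i-1}(L+1)+1\bigr)$, with the convention $P_{-1}(\cdot)=-\infty$. \end{itemize}
   Context: Let $[k]=\{1,\dots,k\}$. Symbols of a word $u$ are indexed from $0$: $u=u[0]u[1]u[2]\cdots$; $u_{<m}$ denotes the prefix of $u$ of length $m$. A subsequence of a word is obtained by deleting some (not necessarily contiguous) symbols. For words $u,u'$ and an integer $i\ge 0$, write $u\prec_i u'$ if one can remove at most $i$ symbols from $u$ and obtain a subsequence of $u'$. For the given $w,w'$ and integers $i\geq 0$ and $0\le L\le \operatorname{len}(w')$, \[ P_i(L)=\max\{m : w_{<m}\prec_i w'_{<L}\}. \] *)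

theory Defs
  imports Main "HOL-Library.Sublist"
begin

text \<open>Finite words are lists, infinite words are functions on \<^typ>\<open>nat\<close>; both are indexed from 0.\<close>

definition inf_prefix :: "(nat \<Rightarrow> 'a) \<Rightarrow> nat \<Rightarrow> 'a list" where
  "inf_prefix w m = map w [0..<m]"

text \<open>The list \<open>v\<close> is what remains of \<open>u\<close> after the removal; the length condition says that
  at most \<open>i\<close> symbols were removed.\<close>

definition prec :: "nat \<Rightarrow> 'a list \<Rightarrow> 'a list \<Rightarrow> bool" where
  "prec i u u' \<longleftrightarrow> (\<exists>v. subseq v u \<and> length u \<le> length v + i \<and> subseq v u')"

definition P :: "(nat \<Rightarrow> 'a) \<Rightarrow> 'a list \<Rightarrow> nat \<Rightarrow> nat \<Rightarrow> nat" where
  "P w w' i L = Max {m. prec i (inf_prefix w m) (take L w')}"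

definition A :: "(nat \<Rightarrow> 'a) \<Rightarrow> 'a list \<Rightarrow> nat \<Rightarrow> nat \<Rightarrow> nat set" where
  "A w w' d L = {i \<in> {0..d}. w (P w w' i L) = w' ! L}"

text \<open>The maximum in \<^const>\<open>P\<close> is over a finite nonempty set, so \<^const>\<open>Max\<close> is meaningful.\<close>

lemma P_set_finite: "finite {m. prec i (inf_prefix w m) u}"
proof (rule finite_subset)
  show "{m. prec i (inf_prefix w m) u} \<subseteq> {..length u + i}"
    by (auto simp: prec_def inf_prefix_def dest!: list_emb_length)
qed simp

lemma P_set_nonempty: "{m. prec i (inf_prefix w m) u} \<noteq> {}"
proof -
  have "prec i (inf_prefix w 0) u"
    by (auto simp: prec_def inf_prefix_def intro: exI[of _ "[]"])
  then show ?thesis by blast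
qed

end

theory Submission
  imports Defs
begin

text \<open>Comparing last symbols gives a recurrence for \<open>prec i (u @ [a]) (v @ [b])\<close>: either \<open>a\<close> is
  matched with \<open>b\<close>, or \<open>b\<close> is not used, or \<open>a\<close> is removed. Since \<^const>\<open>prec\<close> is inherited by
  prefixes of the left word, it holds exactly for the prefixes of length at most \<^const>\<open>P\<close>, and
  the recurrence can be read off in terms of \<^const>\<open>P\<close>. When the last symbols match, the value
  grows by exactly one because \<open>P\<^sub>i\<^sub>-\<^sub>1(L+1) \<le> P\<^sub>i(L)\<close>: instead of using the symbol \<open>w'[L]\<close> one can
  remove one more symbol of \<open>w\<close>.\<close>

lemma subseq_snoc2_iff:
  "subseq x (u @ [a]) \<longleftrightarrow> subseq x u \<or> (\<exists>y. x = y @ [a] \<and> subseq y u)"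
proof
  assume "subseq x (u @ [a])"
  then obtain x1 x2 where x: "x = x1 @ x2" "subseq x1 u" "subseq x2 [a]"
    by (auto elim: subseq_appendE)
  have "x2 = [] \<or> x2 = [a]"
    using x(3) by (cases x2) (auto split: if_splits)
  with x show "subseq x u \<or> (\<exists>y. x = y @ [a] \<and> subseq y u)"
    by auto
qed auto

lemma prec_snoc_left: "prec i u v \<Longrightarrow> prec (Suc i) (u @ [a]) v"
  unfolding prec_def
  by (metis add_Suc_right length_append_singleton not_less_eq_eq subseq_snoc2_iff)

lemma prec_snoc_right: "prec i u v \<Longrightarrow> prec i u (v @ [b])"
  unfolding prec_def by (metis subseq_snoc2_iff)

text \<open>If the kept word \<open>x\<close> uses the final \<open>a\<close>, drop it from
  \<open>x\<close> as well: both lengths fall by one, so the removal budget stays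
  \<open>i\<close>.\<close>

lemma prec_snoc_leftD:
  assumes "prec i (u @ [a]) v"
  shows "prec i u v"
proof -
  obtain x where x: "subseq x (u @ [a])" "length (u @ [a]) \<le> length x + i" "subseq x v"
    using assms by (auto simp: prec_def)
  from x(1) consider "subseq x u" | y where "x = y @ [a]" "subseq y u"
    by (auto simp: subseq_snoc2_iff)
  then show ?thesis
  proof cases
    case 1
    with x show ?thesis by (auto simp: prec_def)
  next
    case 2
    then have "subseq y v"
      using x(3) subseq_order.trans[of y "y @ [a]" v]
        subseq_snoc2_iff[of y y a] by simp
    with 2 x(2) show ?thesis by (auto simp: prec_def)
  qed
qed

text \<open>If the embedding uses \<open>b\<close>, its partner in \<open>u\<close> is removed
  instead, which costs the one extra removal.\<close>

lemma prec_snoc_rightD: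
  assumes "prec i u (v @ [b])"
  shows "prec (Suc i) u v"
proof -
  obtain x where x: "subseq x u" "length u \<le> length x + i" "subseq x (v @ [b])"
    using assms by (auto simp: prec_def)
  from x(3) consider "subseq x v" | y where "x = y @ [b]" "subseq y v"
    by (auto simp: subseq_snoc2_iff)
  then show ?thesis
  proof cases
    case 1
    with x show ?thesis by (auto simp: prec_def)
  next
    case 2
    then have "subseq y u"
      using x(1) subseq_order.trans[of y "y @ [b]" u]
        subseq_snoc2_iff[of y y b] by simp
    with 2 x(2) show ?thesis by (auto simp: prec_def)
  qed
qed

lemma prec_snoc_snoc:
  "prec i (u @ [a]) (v @ [b]) \<longleftrightarrow>
     a = b \<and> prec i u v \<or> prec i (u @ [a]) v \<or> (\<exists>j. i = Suc j \<and> prec j u (v @ [b]))"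
    (is "?lhs \<longleftrightarrow> ?match \<or> ?skip \<or> ?remove")
proof
  assume ?lhs
  then obtain x where x: "subseq x (u @ [a])" "length (u @ [a]) \<le> length x + i"
      "subseq x (v @ [b])"
    by (auto simp: prec_def)
  show "?match \<or> ?skip \<or> ?remove"
  proof (cases "subseq x u")
    case True
    then have "length x \<le> length u" by (rule list_emb_length)
    \<comment> \<open>Here \<open>a\<close> itself is removed. A word no longer than
      \<open>u\<close> cannot meet the length bound with \<open>i = 0\<close>, so one removal can be
      charged to \<open>a\<close>.\<close>
    with x(2) obtain j where "i = Suc j" "length u \<le> length x + j"
      by (cases i) auto
    with True x(3) have ?remove by (auto simp: prec_def)
    then show ?thesis by blast
  next
    case False
    with x(1) obtain y where y: "x = y @ [a]" "subseq y u"
      by (auto simp: subseq_snoc2_iff)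
    from x(3) consider "subseq x v" | "a = b" "subseq y v"
      using y(1) by (auto simp: subseq_snoc2_iff)
    then show ?thesis
    proof cases
      case 1
      with x have ?skip by (auto simp: prec_def)
      then show ?thesis by blast
    next
      case 2
      with x(2) y have ?match by (auto simp: prec_def)
      then show ?thesis by blast
    qed
  qed
next
  have ?lhs if m: ?match
  proof -
    obtain x where "subseq x u" "length u \<le> length x + i" "subseq x v"
      using m by (auto simp: prec_def)
    then show ?thesis
      using m by (auto simp: prec_def intro!: exI[of _ "x @ [a]"])
  qed
  moreover have ?lhs if ?skip
    using that by (rule prec_snoc_right)
  moreover have ?lhs if ?remove
    using that by (auto intro: prec_snoc_left)
  ultimately show "?match \<or> ?skip \<or> ?remove \<Longrightarrow> ?lhs" by blast
qed

lemma inf_prefix_Suc: "inf_prefix w (Suc m) = inf_prefix w m @ [w m]"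
  by (simp add: inf_prefix_def)

lemma prec_inf_prefix_mono:
  assumes "m \<le> n" "prec i (inf_prefix w n) v"
  shows "prec i (inf_prefix w m) v"
  using assms by (induction rule: dec_induct) (auto simp: inf_prefix_Suc dest: prec_snoc_leftD)

text \<open>The admissible lengths are downward closed and contain their maximum. This turns every
  statement about \<open>prec\<close> into an inequality on \<open>P\<close>.\<close>

lemma prec_inf_prefix_iff:
  "prec i (inf_prefix w m) (take L w') \<longleftrightarrow> m \<le> P w w' i L"
proof
  assume "prec i (inf_prefix w m) (take L w')"
  then show "m \<le> P w w' i L"
    unfolding P_def by (intro Max_ge P_set_finite) simp
next
  have "prec i (inf_prefix w (P w w' i L)) (take L w')"
    using Max_in[OF P_set_finite P_set_nonempty, of i w "take L w'"] by (simp add: P_def)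
  then show "m \<le> P w w' i L \<Longrightarrow> prec i (inf_prefix w m) (take L w')"
    using prec_inf_prefix_mono by blast
qed

lemma P_Suc_le:
  assumes "L < length w'"
  shows "P w w' i (Suc L) \<le> P w w' (Suc i) L"
  using prec_snoc_rightD[of i "inf_prefix w (P w w' i (Suc L))" "take L w'" "w' ! L"]
  unfolding take_Suc_conv_app_nth[OF assms, symmetric] prec_inf_prefix_iff by simp

text \<open>This is \<open>prec_snoc_snoc\<close> for prefixes of \<open>w\<close>. Only lengths
  \<open>Suc m\<close> occur, since the left word must have a last symbol
  \<open>w m\<close>.\<close>

lemma le_P_Suc_iff:
  assumes "L < length w'"
  shows "Suc m \<le> P w w' i (Suc L) \<longleftrightarrow>
    w m = w' ! L \<and> m \<le> P w w' i L \<or> Suc m \<le> P w w' i L \<or>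
    (\<exists>j. i = Suc j \<and> m \<le> P w w' j (Suc L))"
  using prec_snoc_snoc[of i "inf_prefix w m" "w m" "take L w'" "w' ! L"]
  unfolding inf_prefix_Suc[symmetric] take_Suc_conv_app_nth[OF assms, symmetric]
    prec_inf_prefix_iff .

text \<open>Lets \<open>le_P_Suc_iff\<close>, which is silent on length 0, determine
  \<open>P\<close>: the instances \<open>p - 1\<close> and \<open>q - 1\<close> give both
  inequalities.\<close>

lemma nat_eq_if_same_Suc_lower_bounds:
  fixes p q :: nat
  assumes "\<And>m. Suc m \<le> p \<longleftrightarrow> Suc m \<le> q"
  shows "p = q"
  using assms[of "p - 1"] assms[of "q - 1"] by (cases p; cases q) auto

lemma P_Suc_match:
  assumes "L < length w'" "w (P w w' i L) = w' ! L"
  shows "P w w' i (Suc L) = Suc (P w w' i L)"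
proof (rule nat_eq_if_same_Suc_lower_bounds)
  fix m
  \<comment> \<open>So the removal disjunct never reaches beyond
    \<open>Suc (P w w' i L)\<close>.\<close>
  have "m \<le> P w w' i L" if "i = Suc j" "m \<le> P w w' j (Suc L)" for j
    using that P_Suc_le[OF assms(1), of w j] by simp
  then show "Suc m \<le> P w w' i (Suc L) \<longleftrightarrow> Suc m \<le> Suc (P w w' i L)"
    unfolding le_P_Suc_iff[OF assms(1)] using assms(2) by (cases "m = P w w' i L") auto
qed

lemma P_Suc_mismatch:
  assumes "L < length w'" "w (P w w' i L) \<noteq> w' ! L"
  shows "P w w' i (Suc L) =
    (case i of 0 \<Rightarrow> P w w' i L | Suc j \<Rightarrow> max (P w w' i L) (P w w' j (Suc L) + 1))"
proof (rule nat_eq_if_same_Suc_lower_bounds)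
  fix m
  \<comment> \<open>The mismatch excludes \<open>m = P w w' i L\<close>, so the match disjunct is
    absorbed by the one that skips \<open>w' ! L\<close>.\<close>
  have "w m = w' ! L \<and> m \<le> P w w' i L \<Longrightarrow> Suc m \<le> P w w' i L"
    using assms(2) by (auto simp: le_less Suc_le_eq)
  then show "Suc m \<le> P w w' i (Suc L) \<longleftrightarrow> Suc m \<le>
      (case i of 0 \<Rightarrow> P w w' i L | Suc j \<Rightarrow> max (P w w' i L) (P w w' j (Suc L) + 1))"
    \<comment> \<open>For \<open>i = 0\<close> the removal disjunct is empty, which realizes the
      convention that \<open>P\<close> at index -1 is minus infinity.\<close>
    unfolding le_P_Suc_iff[OF assms(1)] by (auto simp: le_max_iff_disj split: nat.split)
qed

theorem proposition6:
  fixes k d L :: nat and w :: "nat \<Rightarrow> nat" and w' :: "nat list"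
  assumes "k \<ge> 1"
    and "\<forall>n. w n \<in> {1..k}"
    and "set w' \<subseteq> {1..k}"
    and "length w' \<ge> L + 1"
  shows "\<forall>i\<in>{0..d}.
    (i \<in> A w w' d L \<longrightarrow> P w w' i (L + 1) = P w w' i L + 1) \<and>
    (i \<notin> A w w' d L \<longrightarrow> P w w' i (L + 1) =
       (case i of 0 \<Rightarrow> P w w' i L
        | Suc j \<Rightarrow> max (P w w' i L) (P w w' j (L + 1) + 1)))"
proof -
  have "L < length w'" using assms(4) by simp
  then show ?thesis
    using P_Suc_match[of L w' w] P_Suc_mismatch[of L w' w]
    by (auto simp: A_def split: nat.split)
qed

end
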